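(* Let $d^*$ be a symmetric approximate design (for given $n$, $k$, $t$) such that $\operatorname{tr}(C_{d^*}[\phi]) \ge \operatorname{tr}(C_d[\phi])$ for every symmetric approximate design $d$ (with the same $n$, $k$, $t$). Then $d^*$ is universally optimal for $\phi$ among all approximate designs with the same $n$, $k$, $t$.
   Context: Fix positive integers $n$ (subjects), $k$ (periods), $t$ (treatments, labelled $1,\ldots,t$). Let $\mathcal S=\{1,\ldots,t\}^k$ be the set of sequences of $k$ treatments. An (approximate) design $d$ is given by proportions $\pi_d(s)\ge 0$, $s\in\mathcal S$, with $\sum_{s}\pi_d(s)=1$ (an exact design with $n$ subjects corresponds to all $\pi_d(s)$ being multiples of $1/n$, where $\pi_d(s)$ is the proportion of subjects receiving $s$). The underlying model is $y_{ij}=\beta_i+\xi_{d(i,j),d(i,j-1)}+\varepsilon_{ij}$ with $d(i,0)=0$ (fictitious treatment $0$ before period 1), uncorrelated errors of common variance. Index the coordinates of $\mathbb R^{t(t+1)}$ by pairs $uv$ with $u\in\{1,\ldots,t\}$, $v\in\{0,1,\ldots,t\}$. For $s=(s_1,\ldots,s_k)\in\mathcal S$ put $s_0=0$ and let $X_s$ be the $k\times t(t+1)$ matrix whose $(j,uv)$ entry is $1$ if $s_j=u$ and $s_{j-1}=v$, and $0$ otherwise. Let $Q_m=I_m-m^{-1}J_m$ where $J_m$ is the $m\times m$ all-ones matrix. Put $C_s[\xi]=X_s'Q_kX_s$ and $$C_d[\xi]=n\sum_{s\in\mathcal S}\pi_d(s)\,C_s[\xi].$$ Let $K$ be the $t(t+1)\times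 t$ matrix with entries $K_{uv}^w=1$ if $u=v=w$ and $0$ otherwise ($uv$ row index, $w$ column index), so that $\phi=K'\xi$ is the vector of total effects $\phi_u=\xi_{uu}$. The information matrix for $\phi$ is $$C_d[\phi]=\min\{L'C_d[\xi]L : L\in\mathbb R^{t(t+1)\times t},\ L'K=I_t\},$$ the minimum being with respect to the Loewner ordering (it exists and is unique). For a permutation $\sigma$ of $\{1,\ldots,t\}$, $s_\sigma$ denotes the sequence obtained from $s$ by applying $\sigma$ to each treatment label. A design $d$ is symmetric if $\pi_d(s_\sigma)=\pi_d(s)$ for all $s\in\mathcal S$ and all permutations $\sigma$ of $\{1,\ldots,t\}$. Universal optimality (Kiefer): $d^*$ is universally optimal for $\phi$ in a class of designs if $\Phi(C_{d^*}[\phi])\le\Phi(C_d[\phi])$ for every $d$ in the class and every function $\Phi$ from the set of $t\times t$ symmetric nonnegative definite matrices with zero row and column sums to $(-\infty,+\infty]$ that is convex, is invariant under simultaneous permutation of rows and columns, and is such that $b\mapsto\Phi(bC)$ is nonincreasing on $b\ge 0$ for each $C$. *)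

theory Defs
  imports "HOL-Analysis.Analysis"
begin

text \<open>
  Treatments are the elements of a finite type \<open>'t\<close> (so \<open>t = CARD('t)\<close>), periods are the elements
  of a finite linearly ordered type \<open>'k\<close> (so \<open>k = CARD('k)\<close>), and a sequence of treatments is an
  element of \<open>'t^'k\<close>. The fictitious treatment \<open>0\<close> is \<open>None\<close>; hence the index pairs \<open>uv\<close>
  are the elements of \<open>'t \<times> 't option\<close>, a type with \<open>t (t + 1)\<close> elements.
\<close>

type_synonym ('t, 'k) design = "'t^'k \<Rightarrow> real"

text \<open>The treatment \<open>s\<^sub>j\<^sub>-\<^sub>1\<close>, where \<open>s\<^sub>0\<close> is the fictitious treatment.\<close>

definition previous :: "('t, 'k::{finite,linorder}) vec \<Rightarrow> 'k \<Rightarrow> 't option" where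
  "previous s j = (if \<exists>i. i < j then Some (s $ Max {i. i < j}) else None)"

definition X :: "('t::finite, 'k::{finite,linorder}) vec \<Rightarrow> ((real, 't \<times> 't option) vec, 'k) vec" where
  "X s = (\<chi> j uv. if s $ j = fst uv \<and> previous s j = snd uv then 1 else 0)"

definition Q :: "real^'m^'m" where
  "Q = mat 1 - (1 / real CARD('m)) *\<^sub>R (\<chi> i j. 1)"

definition C_seq ::
  "('t::finite, 'k::{finite,linorder}) vec \<Rightarrow> real^('t \<times> 't option)^('t \<times> 't option)" where
  "C_seq s = transpose (X s) ** Q ** X s"

definition C_xi ::
  "nat \<Rightarrow> ('t::finite, 'k::{finite,linorder}) design \<Rightarrow> real^('t \<times> 't option)^('t \<times> 't option)" where
  "C_xi n d = real n *\<^sub>R (\<Sum>s\<in>UNIV. d s *\<^sub>R C_seq s)"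

text \<open>The matrix with \<open>K' \<xi> = \<phi>\<close>, i.e. \<open>\<phi>\<^sub>u = \<xi>\<^sub>u\<^sub>u\<close>.\<close>

definition K :: "real^'t::finite^('t \<times> 't option)" where
  "K = (\<chi> uv w. if fst uv = w \<and> snd uv = Some w then 1 else 0)"

definition nonneg_definite :: "real^'m^'m \<Rightarrow> bool" where
  "nonneg_definite A \<longleftrightarrow> transpose A = A \<and> (\<forall>x. 0 \<le> x \<bullet> (A *v x))"

definition loewner_le :: "real^'m^'m \<Rightarrow> real^'m^'m \<Rightarrow> bool" where
  "loewner_le A B \<longleftrightarrow> nonneg_definite (B - A)"

definition is_loewner_min :: "(real^'m^'m) set \<Rightarrow> real^'m^'m \<Rightarrow> bool" where
  "is_loewner_min S M \<longleftrightarrow> M \<in> S \<and> (\<forall>N\<in>S. loewner_le M N)"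

text \<open>The Loewner minimum below exists and is unique, so the definite description denotes it.\<close>

definition C_phi :: "nat \<Rightarrow> ('t::finite, 'k::{finite,linorder}) design \<Rightarrow> real^'t^'t" where
  "C_phi n d =
     (THE M. is_loewner_min
        {transpose L ** C_xi n d ** L | L :: real^'t^('t \<times> 't option). transpose L ** K = mat 1} M)"

definition approximate_designs :: "('t::finite, 'k::finite) design set" where
  "approximate_designs = {d. (\<forall>s. 0 \<le> d s) \<and> (\<Sum>s\<in>UNIV. d s) = 1}"

definition relabel :: "('t \<Rightarrow> 't) \<Rightarrow> 't^'k \<Rightarrow> 't^'k" where
  "relabel \<sigma> s = (\<chi> j. \<sigma> (s $ j))"

definition symmetric_designs :: "('t::finite, 'k::finite) design set" where
  "symmetric_designs =
     {d \<in> approximate_designs. \<forall>\<sigma> s. bij \<sigma> \<longrightarrow> d (relabel \<sigma> s) = d s}"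

definition info_matrices :: "(real^'t^'t) set" where
  "info_matrices =
     {A. nonneg_definite A \<and> (\<forall>i. (\<Sum>j\<in>UNIV. A $ i $ j) = 0) \<and> (\<forall>j. (\<Sum>i\<in>UNIV. A $ i $ j) = 0)}"

text \<open>
  Criterion functions have domain \<open>info_matrices\<close> and values in \<open>(-\<infinity>, \<infinity>]\<close>;
  the values of \<open>\<Phi>\<close> outside this domain are unconstrained and never used.
\<close>

definition kiefer_criterion :: "(real^'t^'t \<Rightarrow> ereal) \<Rightarrow> bool" where
  "kiefer_criterion \<Phi> \<longleftrightarrow>
     (\<forall>A\<in>info_matrices. \<Phi> A \<noteq> -\<infinity>) \<and>
     (\<forall>A\<in>info_matrices. \<forall>B\<in>info_matrices. \<forall>a::real. 0 < a \<and> a < 1 \<longrightarrow>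
        \<Phi> (a *\<^sub>R A + (1 - a) *\<^sub>R B) \<le> ereal a * \<Phi> A + ereal (1 - a) * \<Phi> B) \<and>
     (\<forall>A\<in>info_matrices. \<forall>\<sigma>. bij \<sigma> \<longrightarrow> \<Phi> (\<chi> i j. A $ \<sigma> i $ \<sigma> j) = \<Phi> A) \<and>
     (\<forall>A\<in>info_matrices. antimono_on {0::real..} (\<lambda>b. \<Phi> (b *\<^sub>R A)))"

definition universally_optimal ::
  "nat \<Rightarrow> ('t::finite, 'k::{finite,linorder}) design set \<Rightarrow> ('t, 'k) design \<Rightarrow> bool" where
  "universally_optimal n D d_opt \<longleftrightarrow>
     d_opt \<in> D \<and>
     (\<forall>\<Phi>. kiefer_criterion \<Phi> \<longrightarrow> (\<forall>d\<in>D. \<Phi> (C_phi n d_opt) \<le> \<Phi> (C_phi n d)))"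

end

theory Submission
  imports Defs
begin

text \<open>
  Averaging a design over all relabellings of the treatments does not lower the trace of its
  information matrix for \<open>\<phi>\<close>, and averaging an information matrix over all simultaneous
  permutations of rows and columns does not raise a Kiefer criterion. Every information matrix that is
  invariant under these permutations lies on the single ray \<open>{b Q | b \<ge> 0}\<close> of completely symmetric
  matrices with zero row sums, and on a ray such matrices are ordered by their trace.

  In detail, let \<open>d\<close> be a design, \<open>M\<close> the average of \<open>C_phi n d\<close> over simultaneous permutations and
  \<open>d'\<close> the average of \<open>d\<close> over relabellings. A relabelling of \<open>d\<close> permutes \<open>C_phi n d\<close>
  (\<open>C_phi_relabel\<close>), and \<open>C_phi\<close> is Loewner concave in the design (\<open>C_phi_concave\<close>), because it is a
  minimum of functions that are linear in the design. Hence the trace of \<open>M\<close>, which is that of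
  \<open>C_phi n d\<close>, is at most that of \<open>C_phi n d'\<close>, and so at most that of the trace-optimal symmetric
  design. As \<open>M\<close> and the information matrix of that design are multiples of \<open>Q\<close>
  (\<open>reindex_invariant_imp_scaled_Q\<close>), monotonicity of the criterion along the ray compares their
  values, and convexity with invariance (\<open>kiefer_criterion_average\<close>) compares \<open>M\<close> with \<open>C_phi n d\<close>.

  What makes the Loewner minimum accessible is its characterization by Lagrange multipliers: for
  nonnegative definite \<open>C\<close>, \<open>M\<close> is the minimum of \<open>L' C L\<close> subject to \<open>L' H = 1\<close> as soon as \<open>C L = H M\<close> for some admissible \<open>L\<close>, and
  these equations are solvable whenever the constraint is. Existence of the minimum, its zero row sums and its behaviour
  under relabelling are all read off from these linear equations.
\<close>

section \<open>Nonnegative definite matrices\<close>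

lemma nonneg_definite_congruence:
  fixes A :: "real^'m^'m" and B :: "real^'n^'m"
  assumes "nonneg_definite A"
  shows "nonneg_definite (transpose B ** A ** B)"
proof -
  have "x \<bullet> ((transpose B ** A ** B) *v x) = (B *v x) \<bullet> (A *v (B *v x))" for x
    by (metis dot_lmul_matrix matrix_vector_mul_assoc transpose_matrix_vector transpose_transpose)
  then show ?thesis
    using assms by (simp add: nonneg_definite_def matrix_transpose_mul matrix_mul_assoc)
qed

lemma nonneg_definite_scaleR:
  "nonneg_definite A \<Longrightarrow> 0 \<le> c \<Longrightarrow> nonneg_definite (c *\<^sub>R A)"
  by (simp add: nonneg_definite_def transpose_scalar scaleR_matrix_vector_assoc[symmetric])

lemma nonneg_definite_0: "nonneg_definite (0 :: real^'m^'m)"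
  by (simp add: nonneg_definite_def transpose_def vec_eq_iff)

lemma nonneg_definite_add:
  "nonneg_definite A \<Longrightarrow> nonneg_definite B \<Longrightarrow> nonneg_definite (A + B)"
  by (simp add: nonneg_definite_def transpose_def vec_eq_iff matrix_vector_mult_add_rdistrib
      inner_add_right)

lemma nonneg_definite_sum:
  "(\<And>i. i \<in> I \<Longrightarrow> nonneg_definite (A i)) \<Longrightarrow> nonneg_definite (\<Sum>i\<in>I. A i)"
  by (induction I rule: infinite_finite_induct)
     (simp_all add: nonneg_definite_0 nonneg_definite_add)

lemma nonneg_definite_null_vector:
  assumes "nonneg_definite A" and "x \<bullet> (A *v x) = 0"
  shows "A *v x = 0"
proof -
  define q c e where "q = (A *v x) \<bullet> (A *v x)" and "c = (A *v x) \<bullet> (A *v (A *v x))"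
    and "e = - q / (c + 1)"
  have c: "0 \<le> c"
    using assms by (simp add: nonneg_definite_def c_def)
  have sym: "x \<bullet> (A *v y) = (A *v x) \<bullet> y" for y
    by (metis assms(1) dot_lmul_matrix nonneg_definite_def transpose_matrix_vector)
  \<comment> \<open>The quadratic form at \<open>x + e A x\<close> is \<open>2 e q + e\<^sup>2 c\<close>; for this negative \<open>e\<close> the linear
    term dominates.\<close>
  have "0 \<le> (x + e *\<^sub>R (A *v x)) \<bullet> (A *v (x + e *\<^sub>R (A *v x)))"
    using assms by (simp only: nonneg_definite_def)
  also have "\<dots> = 2 * e * q + e\<^sup>2 * c"
    using assms(2)
    by (simp add: matrix_vector_right_distrib inner_add_left inner_add_right sym
        matrix_vector_mult_scaleR q_def c_def power2_eq_square algebra_simps)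
  also have "\<dots> = - q\<^sup>2 * (c + 2) / (c + 1)\<^sup>2"
    using c by (simp add: e_def divide_simps) (simp add: algebra_simps power2_eq_square)
  finally have "q\<^sup>2 * (c + 2) \<le> 0"
    using c by (simp add: field_simps zero_le_divide_iff)
  then have "q\<^sup>2 = 0"
    using c by (smt (verit) mult_pos_pos zero_le_power2)
  then show ?thesis
    by (simp add: q_def)
qed

lemma trace_scaleR: "trace (c *\<^sub>R A :: real^'m^'m) = c * trace A"
  by (simp add: trace_def sum_distrib_left)

lemma trace_sum: "trace (\<Sum>i\<in>I. A i :: real^'m^'m) = (\<Sum>i\<in>I. trace (A i))"
  by (simp add: trace_def sum.swap[of _ I])

lemma trace_mono_loewner:
  fixes A B :: "real^'m^'m"
  assumes "loewner_le A B"
  shows "trace A \<le> trace B"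
proof -
  have "0 \<le> (B - A) $ i $ i" for i
  proof -
    have "0 \<le> axis i 1 \<bullet> ((B - A) *v axis i 1)"
      using assms by (simp only: loewner_le_def nonneg_definite_def)
    then show ?thesis
      by (simp add: inner_axis' matrix_vector_mul_component column_def matrix_vector_mult_basis)
  qed
  then show ?thesis
    by (simp add: trace_def sum_mono)
qed

lemma loewner_le_antisym:
  fixes A B :: "real^'m^'m"
  assumes "loewner_le A B" "loewner_le B A"
  shows "A = B"
proof -
  have "x \<bullet> ((B - A) *v x) = 0" for x
  proof -
    have "x \<bullet> ((B - A) *v x) = - (x \<bullet> ((A - B) *v x))"
      by (simp add: matrix_vector_mult_diff_rdistrib inner_diff_right)
    moreover have "0 \<le> x \<bullet> ((B - A) *v x)" "0 \<le> x \<bullet> ((A - B) *v x)"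
      using assms by (simp_all only: loewner_le_def nonneg_definite_def)
    ultimately show ?thesis by linarith
  qed
  then have "(B - A) *v x = 0" for x
    using assms(1) nonneg_definite_null_vector by (auto simp: loewner_le_def)
  then show ?thesis
    by (metis eq_iff_diff_eq_0 matrix_eq matrix_vector_mult_0)
qed

section \<open>Loewner minima through Lagrange multipliers\<close>

text \<open>
  The columns of \<open>H\<close> span the orthogonal complement of the admissible directions, so the equation
  \<open>C L = H M\<close> says that \<open>L\<close> is a critical point of \<open>L \<mapsto> L' C L\<close> with multiplier \<open>M\<close>. For another
  admissible \<open>N\<close> the cross terms then cancel, and \<open>N' C N - M = (N - L)' C (N - L)\<close> is nonnegative
  definite. The multiplier itself is the minimal value: \<open>L' C L = L' H M = M\<close>.
\<close>

lemma loewner_min_of_normal_equations: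
  fixes C :: "real^'m^'m" and H :: "real^'t^'m"
  assumes C: "nonneg_definite C" and L: "transpose L ** H = mat 1" and M: "C ** L = H ** M"
  shows "is_loewner_min {transpose N ** C ** N | N. transpose N ** H = mat 1} M"
proof -
  have M_eq: "M = transpose L ** C ** L"
    by (metis L M matrix_mul_assoc matrix_mul_lid)
  have "loewner_le M (transpose N ** C ** N)" if N: "transpose N ** H = mat 1" for N
  proof -
    have cross: "transpose N ** C ** L = M"
      by (metis M N matrix_mul_assoc matrix_mul_lid)
    have "transpose M = M"
      using nonneg_definite_congruence[OF C, of L] by (simp add: M_eq nonneg_definite_def)
    then have cross': "transpose L ** C ** N = M"
      using cross C
      by (metis nonneg_definite_def matrix_transpose_mul transpose_transpose matrix_mul_assoc)
    have "transpose (N - L) ** C ** (N - L)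
        = transpose N ** C ** N - transpose N ** C ** L
          - transpose L ** C ** N + transpose L ** C ** L"
      by (simp add: transpose_def matrix_matrix_mult_def vec_eq_iff algebra_simps
          sum_subtractf sum.distrib sum_distrib_left)
    also have "\<dots> = transpose N ** C ** N - M"
      by (simp add: cross cross' M_eq[symmetric])
    finally show ?thesis
      using nonneg_definite_congruence[OF C, of "N - L"] by (simp add: loewner_le_def)
  qed
  then show ?thesis
    using L M_eq by (auto simp: is_loewner_min_def)
qed

lemma loewner_min_unique:
  "is_loewner_min S A \<Longrightarrow> is_loewner_min S B \<Longrightarrow> A = B"
  by (auto simp: is_loewner_min_def intro: loewner_le_antisym)

text \<open>
  Minimizing the form of \<open>C\<close> on an affine space has a solution even when \<open>C\<close> is singular. With \<open>y = y0 - v\<close>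
  the claim is that \<open>C y0\<close> lies in the subspace \<open>S\<close> of all \<open>C v + H \<mu>\<close> with \<open>H' v = 0\<close>. Let
  \<open>z\<close> be the component of \<open>C y0\<close> orthogonal to \<open>S\<close>. Orthogonality to the \<open>H \<mu>\<close> gives \<open>H' z = 0\<close>, so
  \<open>C z\<close> is in \<open>S\<close>, whence \<open>z \<bullet> C z = 0\<close> and \<open>C z = 0\<close>. But then \<open>z\<close> is orthogonal to \<open>C y0\<close> too, so it vanishes.
\<close>

lemma normal_equations_solvable_vector:
  fixes C :: "real^'m^'m" and H :: "real^'t^'m"
  assumes C: "nonneg_definite C"
  shows "\<exists>y \<mu>. transpose H *v y = transpose H *v y0 \<and> C *v y = H *v \<mu>"
proof -
  define S where "S = {C *v v + H *v \<mu> | v \<mu>. transpose H *v v = 0}"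
  have "subspace S"
    unfolding subspace_def
  proof (intro conjI ballI allI)
    show "0 \<in> S"
      unfolding S_def by (rule CollectI, rule exI[of _ 0], rule exI[of _ 0]) simp
  next
    fix a b assume "a \<in> S" "b \<in> S"
    then obtain v \<mu> w \<nu> where "a = C *v v + H *v \<mu>" "transpose H *v v = 0"
      "b = C *v w + H *v \<nu>" "transpose H *v w = 0" by (auto simp: S_def)
    then have "a + b = C *v (v + w) + H *v (\<mu> + \<nu>) \<and> transpose H *v (v + w) = 0"
      by (simp add: matrix_vector_right_distrib algebra_simps)
    then show "a + b \<in> S" unfolding S_def by blast
  next
    fix c :: real and a assume "a \<in> S"
    then obtain v \<mu> where "a = C *v v + H *v \<mu>" "transpose H *v v = 0"
      by (auto simp: S_def)
    then have "c *\<^sub>R a = C *v (c *\<^sub>R v) + H *v (c *\<^sub>R \<mu>) \<and> transpose H *v (c *\<^sub>R v) = 0"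
      by (simp add: matrix_vector_mult_scaleR scaleR_add_right)
    then show "c *\<^sub>R a \<in> S" unfolding S_def by blast
  qed
  obtain a z where a: "a \<in> S" and z: "\<And>w. w \<in> S \<Longrightarrow> orthogonal z w" and az: "C *v y0 = a + z"
    using orthogonal_subspace_decomp_exists[of S "C *v y0"] \<open>subspace S\<close>
    by (metis span_eq_iff)
  have "H *v \<mu> \<in> S" for \<mu>
    unfolding S_def by (rule CollectI, rule exI[of _ 0], rule exI[of _ \<mu>]) simp
  then have "(transpose H *v z) \<bullet> \<mu> = 0" for \<mu>
    using z by (simp add: orthogonal_def dot_lmul_matrix)
  then have Hz: "transpose H *v z = 0"
    using inner_eq_zero_iff by blast
  then have "C *v z \<in> S"
    unfolding S_def by (intro CollectI exI[of _ z] exI[of _ 0]) simp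
  then have "C *v z = 0"
    using z C by (auto simp: orthogonal_def intro: nonneg_definite_null_vector)
  then have "z \<bullet> (C *v y0) = 0"
    by (metis C dot_lmul_matrix inner_zero_left nonneg_definite_def transpose_matrix_vector)
  then have "z = 0"
    using z[OF a] by (simp add: az inner_add_right orthogonal_def)
  then obtain v \<mu> where "C *v y0 = C *v v + H *v \<mu>" "transpose H *v v = 0"
    using a az by (auto simp: S_def)
  then have "transpose H *v (y0 - v) = transpose H *v y0 \<and> C *v (y0 - v) = H *v \<mu>"
    by (simp add: matrix_vector_mult_diff_distrib)
  then show ?thesis by blast
qed

lemma normal_equations_solvable:
  fixes C :: "real^'m^'m" and H :: "real^'t^'m"
  assumes C: "nonneg_definite C" and L0: "transpose L0 ** H = mat 1"
  obtains L M where "transpose L ** H = mat 1" "C ** L = H ** M"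
proof -
  \<comment> \<open>The columns of \<open>L\<close> can be corrected one at a time, starting from those of \<open>L0\<close>.\<close>
  have "\<forall>w. \<exists>y \<mu>. transpose H *v y = transpose H *v column w L0 \<and> C *v y = H *v \<mu>"
    using normal_equations_solvable_vector[OF C] by blast
  then obtain y \<mu> where y: "transpose H *v y w = transpose H *v column w L0"
      "C *v y w = H *v \<mu> w" for w
    by metis
  define L where "L = (\<chi> a w. y w $ a)"
  define M where "M = (\<chi> a w. \<mu> w $ a)"
  have "transpose H ** L = transpose H ** L0"
    using y(1) by (simp add: vec_eq_iff L_def matrix_matrix_mult_def matrix_vector_mult_def column_def)
  moreover have "transpose H ** L0 = mat 1"
    using L0 by (metis matrix_transpose_mul transpose_mat transpose_transpose)
  ultimately have "transpose L ** H = mat 1"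
    by (metis matrix_transpose_mul transpose_mat transpose_transpose)
  moreover have "C ** L = H ** M"
    using y(2) by (simp add: vec_eq_iff L_def M_def matrix_matrix_mult_def matrix_vector_mult_def)
  ultimately show ?thesis by (rule that)
qed

section \<open>Information matrices of designs\<close>

text \<open>
  This serves twice: \<open>Q\<close> of size \<open>k\<close> occurs inside \<open>C_seq\<close>, and \<open>Q\<close> of size \<open>t\<close> spans the ray of
  completely symmetric information matrices. The form of \<open>Q\<close> is a sum of squared deviations from
  the mean.
\<close>

lemma Q_info_matrix: "(Q :: real^'m^'m) \<in> info_matrices"
proof -
  have row: "(\<Sum>j\<in>UNIV. (Q :: real^'m^'m) $ i $ j) = 0" for i
    by (simp add: Q_def mat_def sum_subtractf)
  have sym: "transpose (Q :: real^'m^'m) = Q"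
    by (simp add: Q_def mat_def transpose_def vec_eq_iff eq_commute)
  have "(\<Sum>i\<in>UNIV. (Q :: real^'m^'m) $ i $ j) = 0" for j
    using row[of j] sym by (simp add: transpose_def vec_eq_iff)
  moreover have "0 \<le> x \<bullet> (Q *v x)" for x :: "real^'m"
  proof -
    have "Q *v x = mat 1 *v x - ((1 / real CARD('m)) *\<^sub>R (\<chi> i j. 1)) *v x"
      by (simp only: Q_def matrix_vector_mult_diff_rdistrib)
    also have "\<dots> = x - ((\<Sum>i\<in>UNIV. x $ i) / real CARD('m)) *\<^sub>R (\<chi> i. 1)"
      unfolding matrix_vector_mul_lid
      by (simp add: vec_eq_iff matrix_vector_mult_def sum_divide_distrib)
    finally have "Q *v x = x - ((\<Sum>i\<in>UNIV. x $ i) / real CARD('m)) *\<^sub>R (\<chi> i. 1)" .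
    then have "x \<bullet> (Q *v x) = (\<Sum>i\<in>UNIV. (x $ i)\<^sup>2) - (\<Sum>i\<in>UNIV. x $ i)\<^sup>2 / real CARD('m)"
      by (simp add: inner_vec_def power2_eq_square right_diff_distrib sum_subtractf
          sum_distrib_right[symmetric] sum_divide_distrib[symmetric])
    moreover have "(\<Sum>i\<in>UNIV. x $ i)\<^sup>2 \<le> (\<Sum>i\<in>UNIV. (x $ i)\<^sup>2) * real CARD('m)"
      using sum_squared_le_sum_of_squares[of "\<lambda>i. x $ i" UNIV] by simp
    ultimately show ?thesis
      by (simp add: divide_le_eq)
  qed
  ultimately show ?thesis
    using row sym by (simp add: info_matrices_def nonneg_definite_def)
qed

lemma nonneg_definite_C_xi:
  fixes d :: "('t::finite, 'k::{finite,linorder}) design"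
  assumes "\<And>s. 0 \<le> d s"
  shows "nonneg_definite (C_xi n d)"
proof -
  have "nonneg_definite (C_seq s)" for s :: "('t, 'k) vec"
    unfolding C_seq_def using Q_info_matrix[where 'm='k]
    by (intro nonneg_definite_congruence) (simp add: info_matrices_def)
  then show ?thesis
    unfolding C_xi_def using assms
    by (intro nonneg_definite_scaleR nonneg_definite_sum) auto
qed

text \<open>
  In each period exactly one pair \<open>uv\<close> occurs, so \<open>X s\<close> maps the all-ones vector to the all-ones
  vector, which \<open>Q\<close> annihilates.
\<close>

lemma C_xi_one:
  fixes d :: "('t::finite, 'k::{finite,linorder}) design"
  shows "C_xi n d *v 1 = 0"
proof -
  have "X s *v 1 = 1" for s :: "('t, 'k) vec"
  proof -
    have "(\<Sum>uv\<in>UNIV. if s $ j = fst uv \<and> previous s j = snd uv then 1 else 0) = (1::real)" for j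
    proof -
      have "(\<Sum>uv\<in>UNIV. if s $ j = fst uv \<and> previous s j = snd uv then 1 else 0)
          = (\<Sum>uv\<in>UNIV. if uv = (s $ j, previous s j) then 1 else (0::real))"
        by (intro sum.cong) auto
      then show ?thesis by simp
    qed
    then show ?thesis
      by (simp add: X_def vec_eq_iff matrix_vector_mult_def)
  qed
  moreover have "Q *v (1 :: (real, 'k) vec) = 0"
    using Q_info_matrix[where 'm='k]
    by (simp add: info_matrices_def vec_eq_iff matrix_vector_mult_def)
  ultimately have "C_seq s *v 1 = 0" for s :: "('t, 'k) vec"
    by (simp add: C_seq_def flip: matrix_vector_mul_assoc)
  then have "(\<Sum>s\<in>S. d s *\<^sub>R C_seq s) *v 1 = 0" for S :: "('t, 'k) vec set"
    by (induction S rule: infinite_finite_induct)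
       (simp_all add: matrix_vector_mult_add_rdistrib scaleR_matrix_vector_assoc[symmetric])
  then show ?thesis
    by (simp add: C_xi_def scaleR_matrix_vector_assoc[symmetric])
qed

lemma C_phi_eqI:
  fixes d :: "('t::finite, 'k::{finite,linorder}) design"
  assumes "\<And>s. 0 \<le> d s" "transpose L ** K = mat 1" "C_xi n d ** L = K ** M"
  shows "C_phi n d = M"
proof -
  have "is_loewner_min {transpose L ** C_xi n d ** L | L. transpose L ** K = mat 1} M"
    using assms by (intro loewner_min_of_normal_equations nonneg_definite_C_xi)
  then show ?thesis
    unfolding C_phi_def by (blast intro: loewner_min_unique)
qed

lemma C_phi_normal_equations:
  fixes d :: "('t::finite, 'k::{finite,linorder}) design"
  assumes d: "\<And>s. 0 \<le> d s"
  obtains L where "transpose L ** K = mat 1" "C_xi n d ** L = K ** C_phi n d"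
proof -
  \<comment> \<open>\<open>K\<close> itself is admissible as \<open>L\<close>, so the constraint can be met.\<close>
  have "transpose K ** K = (mat 1 :: real^'t^'t)"
  proof -
    have "(\<Sum>uv\<in>UNIV. K $ uv $ i * K $ uv $ j) = (if i = j then 1 else 0 :: real)" for i j :: 't
    proof -
      have "(\<Sum>uv\<in>UNIV. K $ uv $ i * K $ uv $ j)
          = (\<Sum>uv\<in>UNIV. if uv = (i, Some i) then (if i = j then 1 else 0 :: real) else 0)"
        by (intro sum.cong) (auto simp: K_def)
      then show ?thesis by simp
    qed
    then show ?thesis
      by (simp add: transpose_def matrix_matrix_mult_def mat_def vec_eq_iff)
  qed
  then obtain L M where "transpose L ** K = mat 1" "C_xi n d ** L = K ** M"
    by (rule normal_equations_solvable[OF nonneg_definite_C_xi[of d, OF d]])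
  moreover from this have "C_phi n d = M"
    by (intro C_phi_eqI d)
  ultimately show ?thesis
    using that by simp
qed

lemma C_phi_quadratic_form:
  fixes d :: "('t::finite, 'k::{finite,linorder}) design"
  assumes L: "transpose L ** K = mat 1" "C_xi n d ** L = K ** C_phi n d"
  shows "C_phi n d = transpose L ** C_xi n d ** L"
proof -
  have "transpose L ** C_xi n d ** L = (transpose L ** K) ** C_phi n d"
    by (simp only: L(2) flip: matrix_mul_assoc)
  then show ?thesis
    by (simp add: L(1))
qed

lemma C_phi_loewner_le:
  fixes d :: "('t::finite, 'k::{finite,linorder}) design"
  assumes d: "\<And>s. 0 \<le> d s" and N: "transpose N ** K = mat 1"
  shows "loewner_le (C_phi n d) (transpose N ** C_xi n d ** N)"
proof -
  obtain L where "transpose L ** K = mat 1" "C_xi n d ** L = K ** C_phi n d"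
    using C_phi_normal_equations[OF d] .
  then show ?thesis
    using loewner_min_of_normal_equations[OF nonneg_definite_C_xi[OF d]] N
    by (fastforce simp: is_loewner_min_def)
qed

text \<open>
  Multiplying \<open>C L = K M\<close> on the left by the all-ones row vector kills the left side and turns the right side
  into the column sums of \<open>M\<close>, since each column of \<open>K\<close> contains a single \<open>1\<close>.
\<close>

lemma C_phi_info_matrix:
  fixes d :: "('t::finite, 'k::{finite,linorder}) design"
  assumes d: "\<And>s. 0 \<le> d s"
  shows "C_phi n d \<in> info_matrices"
proof -
  obtain L where L: "transpose L ** K = mat 1" "C_xi n d ** L = K ** C_phi n d"
    using C_phi_normal_equations[OF d] .
  have nd: "nonneg_definite (C_phi n d)"
    by (subst C_phi_quadratic_form[OF L])
       (intro nonneg_definite_congruence nonneg_definite_C_xi d)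
  have "transpose (C_xi n d) = C_xi n d"
    using nonneg_definite_C_xi[of d, OF d] by (simp add: nonneg_definite_def)
  then have "1 v* C_xi n d = 0"
    by (metis C_xi_one transpose_matrix_vector)
  then have "1 v* (K ** C_phi n d) = 0"
    by (metis L(2) vector_matrix_mul_assoc vector_matrix_mult_0)
  moreover have "1 v* K = (1 :: real^'t)"
  proof -
    have "(\<Sum>uv\<in>UNIV. K $ uv $ w) = (1 :: real)" for w :: 't
    proof -
      have "(\<Sum>uv\<in>UNIV. K $ uv $ w) = (\<Sum>uv\<in>UNIV. if uv = (w, Some w) then 1 else (0::real))"
        by (intro sum.cong) (auto simp: K_def)
      then show ?thesis by simp
    qed
    then show ?thesis
      by (simp add: vec_eq_iff vector_matrix_mult_def)
  qed
  ultimately have "1 v* C_phi n d = 0"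
    by (metis vector_matrix_mul_assoc)
  then have "(\<Sum>i\<in>UNIV. C_phi n d $ i $ j) = 0" for j
    by (simp add: vec_eq_iff vector_matrix_mult_def)
  moreover have "C_phi n d $ i $ j = C_phi n d $ j $ i" for i j
    using nd by (auto simp: nonneg_definite_def transpose_def vec_eq_iff)
  ultimately show ?thesis
    using nd by (simp add: info_matrices_def)
qed

section \<open>Relabelling the treatments\<close>

definition reindex :: "('a \<Rightarrow> 'b) \<Rightarrow> ('c \<Rightarrow> 'd) \<Rightarrow> real^'d^'b \<Rightarrow> real^'c^'a" where
  "reindex f g A = (\<chi> i j. A $ f i $ g j)"

lemma reindex_mult:
  assumes "bij g"
  shows "reindex f h (A ** B) = reindex f g A ** reindex g h B"
  using sum.reindex_bij_betw[OF assms, of "\<lambda>k. A $ f i $ k * B $ k $ h j" for i j]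
  by (simp add: reindex_def matrix_matrix_mult_def vec_eq_iff)

lemma reindex_mat_1: "bij f \<Longrightarrow> reindex f f (mat 1) = mat 1"
  by (simp add: reindex_def mat_def vec_eq_iff bij_is_inj inj_eq)

lemma transpose_reindex: "transpose (reindex f g A) = reindex g f (transpose A)"
  by (simp add: reindex_def transpose_def)

lemma trace_reindex: "bij f \<Longrightarrow> trace (reindex f f A) = trace A"
  by (simp add: trace_def reindex_def sum.reindex_bij_betw[of f UNIV UNIV "\<lambda>i. A $ i $ i"])

lemma reindex_scaleR: "reindex f g (c *\<^sub>R A) = c *\<^sub>R reindex f g A"
  by (simp add: reindex_def vec_eq_iff)

lemma reindex_sum: "reindex f g (\<Sum>i\<in>I. A i) = (\<Sum>i\<in>I. reindex f g (A i))"
  by (simp add: reindex_def vec_eq_iff)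

lemma reindex_info_matrix:
  assumes f: "bij f" and A: "A \<in> info_matrices"
  shows "reindex f f A \<in> info_matrices"
proof -
  have "x \<bullet> (reindex f f A *v x) = (\<chi> i. x $ inv f i) \<bullet> (A *v (\<chi> i. x $ inv f i))" for x
    by (simp add: inner_vec_def matrix_vector_mult_def reindex_def bij_is_inj[OF f]
        flip: sum.reindex_bij_betw[OF f])
  then show ?thesis
    using A
    by (simp add: info_matrices_def nonneg_definite_def transpose_reindex)
       (simp add: reindex_def sum.reindex_bij_betw[OF f, of "\<lambda>j. A $ _ $ j"]
         sum.reindex_bij_betw[OF f, of "\<lambda>i. A $ i $ _"])
qed

lemma bij_relabel:
  assumes "bij \<sigma>"
  shows "bij (relabel \<sigma> :: 't^'k \<Rightarrow> 't^'k::finite)"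
proof (rule bijI)
  show "inj (relabel \<sigma> :: 't^'k \<Rightarrow> 't^'k)"
    using assms by (auto intro!: injI simp: relabel_def vec_eq_iff bij_is_inj inj_eq)
  show "surj (relabel \<sigma> :: 't^'k \<Rightarrow> 't^'k)"
    using assms by (auto intro!: surjI[of _ "relabel (inv \<sigma>)"]
        simp: relabel_def vec_eq_iff bij_is_surj surj_f_inv_f)
qed

lemma C_seq_relabel:
  fixes s :: "('t::finite, 'k::{finite,linorder}) vec"
  assumes \<sigma>: "bij \<sigma>"
  defines "\<tau> \<equiv> map_prod \<sigma> (map_option \<sigma>)"
  shows "reindex \<tau> \<tau> (C_seq (relabel \<sigma> s)) = C_seq s"
proof -
  have "previous (relabel \<sigma> s) j = map_option \<sigma> (previous s j)" for j
    by (simp add: previous_def relabel_def)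
  moreover have "inj (map_option \<sigma>)" "inj \<sigma>"
    using \<sigma> by (simp_all add: bij_is_inj option.inj_map)
  ultimately have X: "reindex id \<tau> (X (relabel \<sigma> s)) = X s"
    by (simp add: reindex_def X_def \<tau>_def vec_eq_iff relabel_def inj_eq)
  have id: "reindex id id A = A" for A :: "(real, 'x::finite) vec^'y::finite"
    by (simp add: reindex_def)
  show ?thesis
    by (simp add: C_seq_def reindex_mult[of id] X id flip: transpose_reindex)
qed

lemma bij_relabel_index:
  assumes "bij \<sigma>"
  shows "bij (map_prod \<sigma> (map_option \<sigma>))"
proof -
  have "surj (map_option \<sigma>)"
    using assms by (intro surjI[of _ "map_option (inv \<sigma>)"])
      (simp add: option.map_comp comp_def bij_is_surj surj_f_inv_f option.map_ident)
  then have "bij (map_option \<sigma>)"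
    using assms by (simp add: bij_def option.inj_map)
  then show ?thesis
    using assms by (simp add: bij_def map_prod_inj_on map_prod_surj prod.inj_map)
qed

lemma C_xi_relabel:
  fixes d :: "('t::finite, 'k::{finite,linorder}) design"
  assumes \<sigma>: "bij \<sigma>"
  defines "\<tau> \<equiv> map_prod \<sigma> (map_option \<sigma>)"
  shows "C_xi n (d \<circ> relabel \<sigma>) = reindex \<tau> \<tau> (C_xi n d)"
proof -
  have "(\<Sum>s\<in>UNIV. (d \<circ> relabel \<sigma>) s *\<^sub>R C_seq s)
      = (\<Sum>s\<in>UNIV. reindex \<tau> \<tau> (d (relabel \<sigma> s) *\<^sub>R C_seq (relabel \<sigma> s)))"
    by (simp add: reindex_scaleR \<tau>_def C_seq_relabel[OF \<sigma>])
  also have "\<dots> = (\<Sum>s\<in>UNIV. reindex \<tau> \<tau> (d s *\<^sub>R C_seq s))"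
    by (rule sum.reindex_bij_betw[OF bij_relabel[OF \<sigma>]])
  finally show ?thesis
    by (simp add: C_xi_def reindex_scaleR reindex_sum)
qed

text \<open>
  A relabelling of the treatments permutes the pairs \<open>uv\<close> by \<open>\<tau>\<close>, which fixes the fictitious treatment,
  and the effects \<open>\<phi>\<close> by \<open>\<sigma>\<close>. These permutations leave \<open>K\<close> unchanged, so permuting the rows and columns of
  \<open>L\<close> and \<open>M\<close> carries the normal equations of \<open>d\<close> to those of the relabelled design.
\<close>

lemma C_phi_relabel:
  fixes d :: "('t::finite, 'k::{finite,linorder}) design"
  assumes d: "\<And>s. 0 \<le> d s" and \<sigma>: "bij \<sigma>"
  shows "C_phi n (d \<circ> relabel \<sigma>) = reindex \<sigma> \<sigma> (C_phi n d)"
proof -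
  define \<tau> where "\<tau> = map_prod \<sigma> (map_option \<sigma>)"
  have \<tau>: "bij \<tau>"
    using bij_relabel_index[OF \<sigma>] by (simp add: \<tau>_def)
  have K: "reindex \<tau> \<sigma> K = K"
    using \<sigma> by (auto simp: reindex_def K_def \<tau>_def vec_eq_iff bij_is_inj inj_eq)
  obtain L where L: "transpose L ** K = mat 1" "C_xi n d ** L = K ** C_phi n d"
    using C_phi_normal_equations[OF d] .
  show ?thesis
  proof (rule C_phi_eqI)
    show "transpose (reindex \<tau> \<sigma> L) ** K = mat 1"
      using L(1) by (metis K \<sigma> \<tau> reindex_mat_1 reindex_mult transpose_reindex)
    show "C_xi n (d \<circ> relabel \<sigma>) ** reindex \<tau> \<sigma> L = K ** reindex \<sigma> \<sigma> (C_phi n d)"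
      using L(2) by (metis C_xi_relabel K \<sigma> \<tau> \<tau>_def reindex_mult)
  qed (simp add: d)
qed

section \<open>Symmetrization\<close>

lemma congruence_sum:
  fixes A :: "'i \<Rightarrow> real^'m^'m" and L :: "real^'n^'m"
  shows "transpose L ** (\<Sum>i\<in>I. c i *\<^sub>R A i) ** L = (\<Sum>i\<in>I. c i *\<^sub>R (transpose L ** A i ** L))"
proof (induction I rule: infinite_finite_induct)
  case (insert i I)
  have "(B + C) ** L = B ** L + C ** L" for B C :: "real^'m^'n"
    by (simp add: matrix_matrix_mult_def vec_eq_iff sum.distrib distrib_right)
  with insert show ?case
    by (simp add: matrix_add_ldistrib matrix_scalar_ac scalar_matrix_assoc)
qed simp_all

text \<open>
  The matrix \<open>L\<close> that is optimal for the mixture is admissible for each component, where it can only give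
  a larger value than the minimum; the objective \<open>L' C L\<close> is linear in the design.
\<close>

lemma C_phi_concave:
  fixes d :: "'i \<Rightarrow> ('t::finite, 'k::{finite,linorder}) design"
  assumes d: "\<And>i s. i \<in> I \<Longrightarrow> 0 \<le> d i s" and c: "\<And>i. i \<in> I \<Longrightarrow> 0 \<le> c i"
  shows "loewner_le (\<Sum>i\<in>I. c i *\<^sub>R C_phi n (d i)) (C_phi n (\<lambda>s. \<Sum>i\<in>I. c i * d i s))"
proof -
  define D where "D = (\<lambda>s. \<Sum>i\<in>I. c i * d i s)"
  have D: "0 \<le> D s" for s
    using c d by (simp add: D_def sum_nonneg)
  have C_D: "C_xi n D = (\<Sum>i\<in>I. c i *\<^sub>R C_xi n (d i))"
  proof -
    have "(\<Sum>s\<in>UNIV. D s *\<^sub>R C_seq s) = (\<Sum>s\<in>UNIV. \<Sum>i\<in>I. c i *\<^sub>R d i s *\<^sub>R C_seq s)"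
      by (simp add: D_def scaleR_left.sum)
    also have "\<dots> = (\<Sum>i\<in>I. c i *\<^sub>R (\<Sum>s\<in>UNIV. d i s *\<^sub>R C_seq s))"
      by (subst sum.swap) (simp add: scaleR_right.sum)
    finally show ?thesis
      by (simp add: C_xi_def scaleR_right.sum mult.left_commute)
  qed
  obtain L where L: "transpose L ** K = mat 1" "C_xi n D ** L = K ** C_phi n D"
    using C_phi_normal_equations[OF D] .
  have "C_phi n D - (\<Sum>i\<in>I. c i *\<^sub>R C_phi n (d i))
      = (\<Sum>i\<in>I. c i *\<^sub>R (transpose L ** C_xi n (d i) ** L - C_phi n (d i)))"
    by (simp add: C_phi_quadratic_form[OF L] C_D congruence_sum scaleR_diff_right sum_subtractf)
  moreover have "nonneg_definite \<dots>"
    using C_phi_loewner_le[OF d L(1)] c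
    by (intro nonneg_definite_sum nonneg_definite_scaleR) (auto simp: loewner_le_def)
  ultimately show ?thesis
    by (simp add: loewner_le_def D_def)
qed

definition symmetrize :: "('t::finite, 'k::finite) design \<Rightarrow> ('t, 'k) design" where
  "symmetrize d = (\<lambda>s. \<Sum>\<sigma> | bij \<sigma>. 1 / real (card {\<sigma> :: 't \<Rightarrow> 't. bij \<sigma>}) * (d \<circ> relabel \<sigma>) s)"

lemma card_bij_pos: "0 < card {\<sigma> :: 't::finite \<Rightarrow> 't. bij \<sigma>}"
  using bij_id by (auto simp: card_gt_0_iff)

lemma bij_betw_comp_bij:
  assumes "bij \<rho>"
  shows "bij_betw (\<lambda>\<sigma>. \<sigma> \<circ> \<rho>) {\<sigma>. bij \<sigma>} {\<sigma>. bij \<sigma>}"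
  by (rule bij_betw_byWitness[where f' = "\<lambda>\<sigma>. \<sigma> \<circ> inv \<rho>"])
     (use assms in \<open>auto simp: fun_eq_iff bij_is_inj bij_is_surj surj_f_inv_f intro: bij_comp bij_imp_bij_inv\<close>)

lemma symmetrize_symmetric:
  fixes d :: "('t::finite, 'k::{finite,linorder}) design"
  assumes "d \<in> approximate_designs"
  shows "symmetrize d \<in> symmetric_designs"
proof -
  have "(\<Sum>s\<in>UNIV. d (relabel \<sigma> s)) = 1" if "bij \<sigma>" for \<sigma>
    using assms sum.reindex_bij_betw[OF bij_relabel[OF that], of d]
    by (simp add: approximate_designs_def)
  then have "(\<Sum>s\<in>UNIV. symmetrize d s) = 1"
    unfolding symmetrize_def using card_bij_pos[where 't='t]
    by (subst sum.swap) (simp add: sum_divide_distrib[symmetric], metis bij_id)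
  moreover have "0 \<le> symmetrize d s" for s
    using assms by (simp add: symmetrize_def approximate_designs_def sum_nonneg)
  moreover have "symmetrize d (relabel \<rho> s) = symmetrize d s" if \<rho>: "bij \<rho>" for \<rho> s
  proof -
    have "relabel \<sigma> (relabel \<rho> s) = relabel (\<sigma> \<circ> \<rho>) s" for \<sigma>
      by (simp add: relabel_def)
    then have "(\<Sum>\<sigma> | bij \<sigma>. d (relabel \<sigma> (relabel \<rho> s))) = (\<Sum>\<sigma> | bij \<sigma>. d (relabel (\<sigma> \<circ> \<rho>) s))"
      by simp
    also have "\<dots> = (\<Sum>\<sigma> | bij \<sigma>. d (relabel \<sigma> s))"
      by (rule sum.reindex_bij_betw[OF bij_betw_comp_bij[OF \<rho>]])
    finally show ?thesis
      by (simp add: symmetrize_def sum_divide_distrib[symmetric])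
  qed
  ultimately show ?thesis
    by (simp add: symmetric_designs_def approximate_designs_def)
qed

lemma trace_C_phi_symmetrize:
  fixes d :: "('t::finite, 'k::{finite,linorder}) design"
  assumes d: "d \<in> approximate_designs"
  shows "trace (C_phi n d) \<le> trace (C_phi n (symmetrize d))"
proof -
  have nonneg: "0 \<le> d s" for s
    using d by (simp add: approximate_designs_def)
  have "trace (\<Sum>\<sigma> | bij \<sigma>. (1 / real (card {\<sigma> :: 't \<Rightarrow> 't. bij \<sigma>})) *\<^sub>R C_phi n (d \<circ> relabel \<sigma>))
      = trace (C_phi n d)"
    using card_bij_pos[where 't='t]
    by (simp add: trace_sum trace_scaleR C_phi_relabel[of d, OF nonneg] trace_reindex)
       (metis bij_id)
  moreover have "loewner_le (\<Sum>\<sigma> | bij \<sigma>. (1 / real (card {\<sigma> :: 't \<Rightarrow> 't. bij \<sigma>})) *\<^sub>R C_phi n (d \<circ> relabel \<sigma>))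
      (C_phi n (symmetrize d))"
    unfolding symmetrize_def by (rule C_phi_concave) (simp_all add: nonneg)
  ultimately show ?thesis
    using trace_mono_loewner by metis
qed

section \<open>Completely symmetric matrices and optimality\<close>

text \<open>
  Transpositions move any diagonal entry to any other, and any off-diagonal entry to any other in the same
  row; the zero row sums then express the off-diagonal entries through the diagonal. If there is just
  one treatment, both sides are zero and the quotient has the value \<open>0\<close> by \<open>x / 0 = 0\<close>.
\<close>

lemma reindex_invariant_imp_scaled_Q:
  fixes A :: "real^'t^'t"
  assumes A: "A \<in> info_matrices" and inv: "\<And>\<sigma>. bij \<sigma> \<Longrightarrow> reindex \<sigma> \<sigma> A = A"
  shows "A = (trace A / (real CARD('t) - 1)) *\<^sub>R Q"
proof -
  define t where "t = real CARD('t)"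
  have t: "1 \<le> t"
    using card_gt_0_iff[of "UNIV :: 't set"] by (simp add: t_def Suc_le_eq)
  have move: "A $ \<sigma> i $ \<sigma> j = A $ i $ j" if "bij \<sigma>" for \<sigma> i j
    using inv[OF that] by (simp add: reindex_def vec_eq_iff)
  obtain i0 :: 't where True by simp
  define a where "a = A $ i0 $ i0"
  have diag: "A $ i $ i = a" for i
    using move[of "Transposition.transpose i0 i" i0 i0] by (simp add: a_def bij_transpose)
  have trace_A: "trace A = t * a"
    by (simp add: trace_def diag t_def)
  have off: "(t - 1) * A $ i $ j = - a" if "i \<noteq> j" for i j
  proof -
    have "A $ i $ l = A $ i $ j" if "l \<noteq> i" for l
      using move[of "Transposition.transpose j l" i j] \<open>i \<noteq> j\<close> that by simp
    then have "(\<Sum>l\<in>UNIV - {i}. A $ i $ l) = (t - 1) * A $ i $ j"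
      using t by (simp add: t_def of_nat_diff card_Diff_singleton)
    moreover have "(\<Sum>l\<in>UNIV. A $ i $ l) = 0"
      using A by (simp add: info_matrices_def)
    ultimately show ?thesis
      using sum.remove[of UNIV i "\<lambda>l. A $ i $ l"] by (simp add: diag)
  qed
  show ?thesis
  proof (cases "t = 1")
    case True
    then obtain x where "(UNIV :: 't set) = {x}"
      by (metis card_1_singletonE of_nat_eq_1_iff t_def)
    then have one: "i = j" for i j :: 't
      by (metis UNIV_I singletonD)
    have "(\<Sum>l\<in>UNIV. A $ i0 $ l) = 0"
      using A by (simp add: info_matrices_def)
    moreover have "(\<Sum>l\<in>UNIV - {i0}. A $ i0 $ l) = 0"
      using one by (intro sum.neutral) blast
    ultimately have "a = 0"
      using sum.remove[of UNIV i0 "\<lambda>l. A $ i0 $ l"] by (simp add: a_def)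
    then have "A $ i $ j = 0" for i j
      using diag one by metis
    then show ?thesis
      by (simp add: vec_eq_iff trace_def)
  next
    case False
    have "A $ i $ j = trace A / (t - 1) * Q $ i $ j" for i j
    proof (cases "i = j")
      case True
      then show ?thesis
        using t \<open>t \<noteq> 1\<close> by (simp add: diag trace_A Q_def mat_def flip: t_def) (simp add: field_simps)
    next
      case False
      have "A $ i $ j = - a / (t - 1)"
        using off[OF False] \<open>t \<noteq> 1\<close> by (metis eq_iff_diff_eq_0 nonzero_mult_div_cancel_left)
      then show ?thesis
        using t False by (simp add: trace_A Q_def mat_def flip: t_def)
    qed
    then show ?thesis
      by (simp add: vec_eq_iff t_def)
  qed
qed

lemma convex_info_matrices: "convex (info_matrices :: (real^'t^'t) set)"
  by (auto simp: convex_def info_matrices_def sum.distrib sum_distrib_left[symmetric]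
      intro!: nonneg_definite_add nonneg_definite_scaleR)

text \<open>
  Jensen's inequality for finitely many matrices with the same value \<open>r\<close> of \<open>\<Phi>\<close>. As \<open>\<Phi>\<close> may take the
  value \<open>\<infinity>\<close>, it is used in the form that sublevel sets at finite levels are convex.
\<close>

lemma kiefer_criterion_average:
  fixes A :: "real^'t^'t"
  assumes \<Phi>: "kiefer_criterion \<Phi>" and A: "A \<in> info_matrices"
  shows "\<Phi> (\<Sum>\<sigma> | bij \<sigma>. (1 / real (card {\<sigma> :: 't \<Rightarrow> 't. bij \<sigma>})) *\<^sub>R reindex \<sigma> \<sigma> A) \<le> \<Phi> A"
proof (cases "\<Phi> A")
  case (real r)
  have "convex {B \<in> info_matrices. \<Phi> B \<le> ereal r}"
    unfolding convex_alt
  proof (intro ballI allI impI CollectI conjI)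
    fix B C and u :: real
    assume B: "B \<in> {B \<in> info_matrices. \<Phi> B \<le> ereal r}" and C: "C \<in> {B \<in> info_matrices. \<Phi> B \<le> ereal r}"
      and u: "0 \<le> u \<and> u \<le> 1"
    show "(1 - u) *\<^sub>R B + u *\<^sub>R C \<in> info_matrices"
      using B C u convex_info_matrices by (auto simp: convex_alt)
    show "\<Phi> ((1 - u) *\<^sub>R B + u *\<^sub>R C) \<le> ereal r"
    proof (cases "u = 0 \<or> u = 1")
      case True
      then show ?thesis using B C by auto
    next
      case False
      then have "\<Phi> (u *\<^sub>R C + (1 - u) *\<^sub>R B) \<le> ereal u * \<Phi> C + ereal (1 - u) * \<Phi> B"
        using \<Phi> B C u by (auto simp: kiefer_criterion_def)
      also have "\<dots> \<le> ereal u * ereal r + ereal (1 - u) * ereal r"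
        using B C u by (intro add_mono ereal_mult_left_mono) auto
      also have "\<dots> = ereal r"
        by (simp add: algebra_simps)
      finally show ?thesis
        by (simp add: add.commute)
    qed
  qed
  then have "(\<Sum>\<sigma> | bij \<sigma>. (1 / real (card {\<sigma> :: 't \<Rightarrow> 't. bij \<sigma>})) *\<^sub>R reindex \<sigma> \<sigma> A)
      \<in> {B \<in> info_matrices. \<Phi> B \<le> ereal r}"
  proof (rule convex_sum[rotated])
    show "reindex \<sigma> \<sigma> A \<in> {B \<in> info_matrices. \<Phi> B \<le> ereal r}" if "\<sigma> \<in> {\<sigma>. bij \<sigma>}" for \<sigma>
      using that \<Phi> A real reindex_info_matrix[OF _ A]
      by (simp add: kiefer_criterion_def reindex_def)
  qed (use card_bij_pos[where 't='t] in auto)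
  then show ?thesis
    by (simp add: real)
next
  case PInf
  then show ?thesis by simp
next
  case MInf
  then show ?thesis
    using \<Phi> A by (simp add: kiefer_criterion_def)
qed

theorem proposition9:
  fixes n :: nat and d_opt :: "('t::finite, 'k::{finite,linorder}) design"
  assumes "n > 0"
    and "d_opt \<in> symmetric_designs"
    and "\<And>d :: ('t, 'k) design. d \<in> symmetric_designs \<Longrightarrow>
           trace (C_phi n d) \<le> trace (C_phi n d_opt)"
  shows "universally_optimal n approximate_designs d_opt"
proof -
  have opt: "d_opt \<in> approximate_designs" "\<And>s. 0 \<le> d_opt s"
    using assms(2) by (auto simp: symmetric_designs_def approximate_designs_def)
  have "d_opt \<circ> relabel \<sigma> = d_opt" if "bij \<sigma>" for \<sigma>
    using assms(2) that by (auto simp: symmetric_designs_def)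
  then have "reindex \<sigma> \<sigma> (C_phi n d_opt) = C_phi n d_opt" if "bij \<sigma>" for \<sigma>
    using C_phi_relabel[of d_opt, OF opt(2) that] that by metis
  then have C_opt: "C_phi n d_opt = (trace (C_phi n d_opt) / (real CARD('t) - 1)) *\<^sub>R Q"
    using C_phi_info_matrix[of d_opt, OF opt(2)] by (rule reindex_invariant_imp_scaled_Q[rotated])
  have "\<Phi> (C_phi n d_opt) \<le> \<Phi> (C_phi n d)"
    if \<Phi>: "kiefer_criterion \<Phi>" and d: "d \<in> approximate_designs" for \<Phi> and d :: "('t, 'k) design"
  proof -
    define A where "A = C_phi n d"
    define M :: "real^'t^'t" where "M = (\<Sum>\<sigma> | bij \<sigma>. (1 / real (card {\<sigma> :: 't \<Rightarrow> 't. bij \<sigma>})) *\<^sub>R reindex \<sigma> \<sigma> A)"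
    have A: "A \<in> info_matrices"
      using d by (simp add: A_def C_phi_info_matrix approximate_designs_def)
    have M_info: "M \<in> info_matrices"
      unfolding M_def using card_bij_pos[where 't='t]
      by (intro convex_sum convex_info_matrices reindex_info_matrix A) auto
    have "reindex \<rho> \<rho> M = M" if "bij \<rho>" for \<rho>
    proof -
      have "reindex \<rho> \<rho> (reindex \<sigma> \<sigma> A) = reindex (\<sigma> \<circ> \<rho>) (\<sigma> \<circ> \<rho>) A" for \<sigma>
        by (simp add: reindex_def)
      then show ?thesis
        unfolding M_def
        using sum.reindex_bij_betw[OF bij_betw_comp_bij[OF that], of "\<lambda>\<sigma>. reindex \<sigma> \<sigma> A"]
        by (simp add: reindex_sum reindex_scaleR scaleR_right.sum[symmetric])
    qed
    with M_info have M: "M = (trace M / (real CARD('t) - 1)) *\<^sub>R Q"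
      by (rule reindex_invariant_imp_scaled_Q)
    have "trace M = trace A"
      using card_bij_pos[where 't='t] by (simp add: M_def trace_sum trace_scaleR trace_reindex) (metis bij_id)
    also have "\<dots> \<le> trace (C_phi n d_opt)"
      using trace_C_phi_symmetrize[OF d] assms(3)[OF symmetrize_symmetric[OF d]]
      unfolding A_def by (rule order_trans)
    finally have "trace M / (real CARD('t) - 1) \<le> trace (C_phi n d_opt) / (real CARD('t) - 1)"
      by (intro divide_right_mono) (simp_all add: Suc_le_eq card_gt_0_iff)
    moreover have "0 \<le> trace M / (real CARD('t) - 1)"
      using trace_mono_loewner[of 0 M] M_info
      by (simp add: loewner_le_def info_matrices_def trace_def Suc_le_eq card_gt_0_iff)
    moreover have "antimono_on {0::real..} (\<lambda>b. \<Phi> (b *\<^sub>R Q))"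
      using \<Phi> Q_info_matrix[where 'm='t] by (simp add: kiefer_criterion_def)
    \<comment> \<open>Moving along the ray of \<open>Q\<close>, not that of \<open>M\<close>, also covers \<open>M = 0\<close>.\<close>
    then have "\<Phi> (c *\<^sub>R Q) \<le> \<Phi> (b *\<^sub>R Q)" if "b \<le> c" "0 \<le> b" for b c
      using that by (simp add: monotone_on_def)
    ultimately have "\<Phi> (C_phi n d_opt) \<le> \<Phi> M"
      by (subst C_opt, subst M)
    also have "\<dots> \<le> \<Phi> A"
      unfolding M_def using \<Phi> A by (rule kiefer_criterion_average)
    finally show ?thesis
      by (simp add: A_def)
  qed
  then show ?thesis
    using opt(1) by (simp add: universally_optimal_def)
qed

end
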